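(* Let $A$ be a ring and let $\phi:R_3\left[\frac{1}{\delta_{12}\delta_{23}\Delta_x\Delta_y}\right]\to A$ be a ring homomorphism, and write $P_i=(\phi(x_i),\phi(y_i))\in A^2$ for $i=1,2,3$. If $e(P_1)=e(P_2)=e(P_3)=0$ in $A$, then $$(P_1\oplus P_2)\oplus P_3=P_1\oplus(P_2\oplus P_3).$$
   Context: Rings are commutative with $1$. $R_0=\mathbb{Z}[c,d]$ and $R_3=R_0[x_1,y_1,x_2,y_2,x_3,y_3]$ are polynomial rings; $R[\frac1f]$ denotes localization at the powers of $f$. Let $e(x,y)=x^2+cy^2-1-dx^2y^2$; $e(P_i)$ denotes $\phi(e(x_i,y_i))$. For pairs $z_i=(x_i,y_i)$ set $\delta_x(z_1,z_2)=1-dx_1y_1x_2y_2$, $\delta_y(z_1,z_2)=1+dx_1y_1x_2y_2$, and $\delta_{ij}=\delta_x(z_i,z_j)\,\delta_y(z_i,z_j)$. Define $$z_1\oplus z_2=\left(\frac{x_1x_2-cy_1y_2}{1-dx_1x_2y_1y_2},\ \frac{x_1y_2+y_1x_2}{1+dx_1x_2y_1y_2}\right),$$ and for pairs in $A^2$ use the same formula with $c,d$ replaced by $\phi(c),\phi(d)$ (whenever the denominators are units). Let $z_3'=(x_3',y_3')=z_1\oplus z_2$ and $z_1'=(x_1',y_1')=z_2\oplus z_3$, and set $$\Delta_x=\delta_x(z_3',z_3)\,\delta_x(z_1,z_1')\,\delta_{12}\,\delta_{23},\qquad \Delta_y=\delta_y(z_3',z_3)\,\delta_y(z_1,z_1')\,\delta_{12}\,\delta_{23},$$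 which are elements of $R_3$ (the factors $\delta_{12},\delta_{23}$ clear the denominators). *)

theory Defs
  imports
    "HOL-Library.Poly_Mapping"
    "HOL-Library.Numeral_Type"
    "HOL-Computational_Algebra.Fraction_Field"
    "HOL-Algebra.Ring"
begin

section \<open>The polynomial rings and their localizations\<close>

text \<open>
  A polynomial is a finitely supported map from monomials (finitely supported exponent vectors) to
  coefficients. \<open>R0\<close> has the two variables $c, d$ and \<open>R3\<close> the six variables
  $x_1, y_1, x_2, y_2, x_3, y_3$ over \<open>R0\<close>; the variables are numbered from 0 in this order, by
  the elements of the types \<open>2\<close> and \<open>6\<close>.
\<close>

type_synonym R0 = "(2 \<Rightarrow>\<^sub>0 nat) \<Rightarrow>\<^sub>0 int"
type_synonym R3 = "(6 \<Rightarrow>\<^sub>0 nat) \<Rightarrow>\<^sub>0 R0"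

definition pvar :: "'v \<Rightarrow> (('v \<Rightarrow>\<^sub>0 nat) \<Rightarrow>\<^sub>0 'a::comm_ring_1)"
  where "pvar i = Poly_Mapping.single (Poly_Mapping.single i 1) 1"

definition pconst :: "'a::comm_ring_1 \<Rightarrow> (('v \<Rightarrow>\<^sub>0 nat) \<Rightarrow>\<^sub>0 'a)"
  where "pconst a = Poly_Mapping.single 0 a"

text \<open>
  For a nonzero element $f$ of a domain $R$, the localization $R[1/f]$ is the subring of the field
  of fractions of $R$ consisting of all $p / f^n$. The argument \<open>f\<close> is an element of the field of
  fractions, meant to be nonzero and in the image of $R$.
\<close>

definition localization :: "'a::idom fract \<Rightarrow> 'a fract ring"
  where "localization f =
    \<lparr>carrier = {Fract p 1 / f ^ n | p n. True}, mult = (*), one = 1, zero = 0, add = (+)\<rparr>"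


section \<open>The generic Edwards addition\<close>

type_synonym gen_point = "R3 fract \<times> R3 fract"

definition gc :: "R3 fract" where "gc = Fract (pconst (pvar 0)) 1"
definition gd :: "R3 fract" where "gd = Fract (pconst (pvar 1)) 1"

definition z1 :: gen_point where "z1 = (Fract (pvar 0) 1, Fract (pvar 1) 1)"
definition z2 :: gen_point where "z2 = (Fract (pvar 2) 1, Fract (pvar 3) 1)"
definition z3 :: gen_point where "z3 = (Fract (pvar 4) 1, Fract (pvar 5) 1)"

fun curve :: "gen_point \<Rightarrow> R3 fract"
  where "curve (x, y) = x\<^sup>2 + gc * y\<^sup>2 - 1 - gd * x\<^sup>2 * y\<^sup>2"

fun delta_x :: "gen_point \<Rightarrow> gen_point \<Rightarrow> R3 fract"
  where "delta_x (x1, y1) (x2, y2) = 1 - gd * x1 * y1 * x2 * y2"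

fun delta_y :: "gen_point \<Rightarrow> gen_point \<Rightarrow> R3 fract"
  where "delta_y (x1, y1) (x2, y2) = 1 + gd * x1 * y1 * x2 * y2"

definition delta :: "gen_point \<Rightarrow> gen_point \<Rightarrow> R3 fract"
  where "delta z w = delta_x z w * delta_y z w"

fun gen_add :: "gen_point \<Rightarrow> gen_point \<Rightarrow> gen_point"
  where "gen_add (x1, y1) (x2, y2) =
    ((x1 * x2 - gc * y1 * y2) / (1 - gd * x1 * x2 * y1 * y2),
     (x1 * y2 + y1 * x2) / (1 + gd * x1 * x2 * y1 * y2))"

definition z3' :: gen_point where "z3' = gen_add z1 z2"
definition z1' :: gen_point where "z1' = gen_add z2 z3"

definition Delta_x :: "R3 fract"
  where "Delta_x = delta_x z3' z3 * delta_x z1 z1' * delta z1 z2 * delta z2 z3"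

definition Delta_y :: "R3 fract"
  where "Delta_y = delta_y z3' z3 * delta_y z1 z1' * delta z1 z2 * delta z2 z3"

definition denom :: "R3 fract"
  where "denom = delta z1 z2 * delta z2 z3 * Delta_x * Delta_y"


section \<open>Edwards addition over an arbitrary commutative ring\<close>

text \<open>
  \<open>m_inv\<close> is only meaningful on units, so \<open>edwards_add\<close> is to be used together with
  \<open>edwards_defined\<close>.
\<close>

context
  fixes A :: "('a, 'm) ring_scheme" (structure)
begin

fun edwards_defined :: "'a \<Rightarrow> 'a \<times> 'a \<Rightarrow> 'a \<times> 'a \<Rightarrow> bool"
  where "edwards_defined d (x1, y1) (x2, y2) \<longleftrightarrow>
    \<one> \<ominus> d \<otimes> x1 \<otimes> x2 \<otimes> y1 \<otimes> y2 \<in> Units A \<and>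
    \<one> \<oplus> d \<otimes> x1 \<otimes> x2 \<otimes> y1 \<otimes> y2 \<in> Units A"

fun edwards_add :: "'a \<Rightarrow> 'a \<Rightarrow> 'a \<times> 'a \<Rightarrow> 'a \<times> 'a \<Rightarrow> 'a \<times> 'a"
  where "edwards_add c d (x1, y1) (x2, y2) =
    ((x1 \<otimes> x2 \<ominus> c \<otimes> y1 \<otimes> y2) \<otimes> inv (\<one> \<ominus> d \<otimes> x1 \<otimes> x2 \<otimes> y1 \<otimes> y2),
     (x1 \<otimes> y2 \<oplus> y1 \<otimes> x2) \<otimes> inv (\<one> \<oplus> d \<otimes> x1 \<otimes> x2 \<otimes> y1 \<otimes> y2))"

end


section \<open>Well-definedness of the localization at \<open>denom\<close>\<close>

lemma cring_localization:
  assumes f: "f = Fract q 1" and "f \<noteq> 0"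
  shows "cring (localization f)"
proof -
  have pow: "f ^ n = Fract (q ^ n) 1" for n
    by (induction n) (simp_all add: f One_fract_def)
  have f': "f ^ n \<noteq> 0" for n
    using assms by simp
  have mult: "a * b \<in> carrier (localization f)"
    if "a \<in> carrier (localization f)" "b \<in> carrier (localization f)" for a b
  proof -
    from that obtain p r n m where "a = Fract p 1 / f ^ n" "b = Fract r 1 / f ^ m"
      by (auto simp: localization_def)
    then have "a * b = Fract (p * r) 1 / f ^ (n + m)"
      by (simp add: power_add flip: mult_fract[of _ 1 _ 1, simplified])
    then show ?thesis by (auto simp: localization_def)
  qed
  have add: "a + b \<in> carrier (localization f)"
    if "a \<in> carrier (localization f)" "b \<in> carrier (localization f)" for a b
  proof -
    from that obtain p r n m where ab: "a = Fract p 1 / f ^ n" "b = Fract r 1 / f ^ m"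
      by (auto simp: localization_def)
    have "a + b = (Fract p 1 * f ^ m + Fract r 1 * f ^ n) / f ^ (n + m)"
      using f'[of n] f'[of m] by (simp add: ab power_add add_divide_distrib)
    also have "Fract p 1 * f ^ m + Fract r 1 * f ^ n = Fract (p * q ^ m + r * q ^ n) 1"
      by (simp add: pow)
    finally show ?thesis by (auto simp: localization_def)
  qed
  have int: "of_int k \<in> carrier (localization f)" for k
  proof -
    have "of_int k = Fract (of_int k) 1 / f ^ 0"
      by (cases k rule: int_diff_cases) (simp add: of_nat_fract)
    then show ?thesis unfolding localization_def by (simp only: partial_object.simps mem_Collect_eq) blast
  qed
  have zero: "0 \<in> carrier (localization f)" and one: "1 \<in> carrier (localization f)"
    and minus_one: "- 1 \<in> carrier (localization f)"
    using int[of 0] int[of 1] int[of "- 1"] by simp_all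
  show ?thesis
  proof (rule cringI)
    show "abelian_group (localization f)"
    proof (rule abelian_groupI)
      fix a assume "a \<in> carrier (localization f)"
      then have "- a \<in> carrier (localization f)"
        using mult[OF minus_one] by fastforce
      then show "\<exists>b\<in>carrier (localization f).
          b \<oplus>\<^bsub>localization f\<^esub> a = \<zero>\<^bsub>localization f\<^esub>"
        by (intro bexI[of _ "- a"]) (simp_all add: localization_def)
    qed (use add zero in \<open>simp_all add: localization_def algebra_simps\<close>)
    show "Group.comm_monoid (localization f)"
      by (rule comm_monoidI) (use mult one in \<open>simp_all add: localization_def algebra_simps\<close>)
  qed (simp add: localization_def algebra_simps)
qed

text \<open>
  \<open>Delta_x\<close>, \<open>Delta_y\<close> and \<open>denom\<close> are nonzero elements of \<open>R3\<close>: they are polynomials with constant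
  term 1.
\<close>

definition const_term :: "R0 \<Rightarrow> R3 fract set"
  where "const_term k = {Fract p 1 | p. Poly_Mapping.lookup p 0 = k}"

lemma lookup_mult_0:
  fixes p q :: R3
  shows "Poly_Mapping.lookup (p * q) 0 = Poly_Mapping.lookup p 0 * Poly_Mapping.lookup q 0"
proof -
  have *: "(0 = l + k) = (k = 0 \<and> l = 0)" for l k :: "6 \<Rightarrow>\<^sub>0 nat"
    by (auto simp: poly_mapping_eq_iff fun_eq_iff lookup_add)
  have "(\<Sum>k. Poly_Mapping.lookup q k when k = 0 \<and> l = 0) = (Poly_Mapping.lookup q 0 when l = 0)"
    for l :: "6 \<Rightarrow>\<^sub>0 nat"
    by (cases "l = 0") simp_all
  then have "Poly_Mapping.lookup (p * q) 0 =
      (\<Sum>l. Poly_Mapping.lookup p l * (Poly_Mapping.lookup q 0 when l = 0))"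
    unfolding lookup_mult * by simp
  also have "\<dots> = Poly_Mapping.lookup p 0 * Poly_Mapping.lookup q 0"
    by (simp add: mult_when)
  finally show ?thesis .
qed

lemma const_term_mult: "a \<in> const_term k \<Longrightarrow> b \<in> const_term l \<Longrightarrow> a * b \<in> const_term (k * l)"
  by (fastforce simp: const_term_def lookup_mult_0)

lemma const_term_add: "a \<in> const_term k \<Longrightarrow> b \<in> const_term l \<Longrightarrow> a + b \<in> const_term (k + l)"
  by (fastforce simp: const_term_def lookup_add)

lemma const_term_diff: "a \<in> const_term k \<Longrightarrow> b \<in> const_term l \<Longrightarrow> a - b \<in> const_term (k - l)"
  by (fastforce simp: const_term_def lookup_minus)

lemma const_term_1: "1 \<in> const_term 1"
  by (auto simp: const_term_def One_fract_def intro!: exI[of _ 1])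

lemma const_term_pvar: "Fract (pvar i) 1 \<in> const_term 0"
proof -
  have "Poly_Mapping.single i (1::nat) \<noteq> 0"
    by (metis lookup_single_eq lookup_zero zero_neq_one)
  then show ?thesis
    by (auto simp: const_term_def pvar_def lookup_single)
qed

lemma const_term_pconst: "Fract (pconst k) 1 \<in> const_term k"
  by (auto simp: const_term_def pconst_def lookup_single)

lemma const_term_nonzero: "a \<in> const_term 1 \<Longrightarrow> a \<noteq> 0"
  by (auto simp: const_term_def Zero_fract_def eq_fract)

lemma z_in_const_term:
  "fst z1 \<in> const_term 0" "snd z1 \<in> const_term 0" "fst z2 \<in> const_term 0"
  "snd z2 \<in> const_term 0" "fst z3 \<in> const_term 0" "snd z3 \<in> const_term 0"
  by (simp_all add: z1_def z2_def z3_def const_term_pvar)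

lemma gc_in_const_term: "gc \<in> const_term (pvar 0)" and gd_in_const_term: "gd \<in> const_term (pvar 1)"
  by (simp_all add: gc_def gd_def const_term_pconst)

lemma delta_const_term:
  assumes "fst z \<in> const_term 0" "snd z \<in> const_term 0" "fst w \<in> const_term 0" "snd w \<in> const_term 0"
  shows "delta_x z w \<in> const_term 1" "delta_y z w \<in> const_term 1" "delta z w \<in> const_term 1"
proof -
  obtain x1 y1 x2 y2 where zw: "z = (x1, y1)" "w = (x2, y2)"
    by (cases z, cases w)
  have m: "gd * x1 * y1 * x2 * y2 \<in> const_term (pvar 1 * 0 * 0 * 0 * 0)"
    using assms by (intro const_term_mult gd_in_const_term) (simp_all add: zw)
  show "delta_x z w \<in> const_term 1" "delta_y z w \<in> const_term 1"
    using const_term_diff[OF const_term_1 m] const_term_add[OF const_term_1 m] by (simp_all add: zw)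
  from const_term_mult[OF this] show "delta z w \<in> const_term 1"
    by (simp add: delta_def)
qed

lemma delta_gen_add_const_term:
  assumes "fst z \<in> const_term 0" "snd z \<in> const_term 0" "fst w \<in> const_term 0" "snd w \<in> const_term 0"
    and "fst v \<in> const_term 0" "snd v \<in> const_term 0"
  shows "delta_x (gen_add z w) v * delta z w \<in> const_term 1"
    and "delta_y (gen_add z w) v * delta z w \<in> const_term 1"
    and "delta_x v (gen_add z w) * delta z w \<in> const_term 1"
    and "delta_y v (gen_add z w) * delta z w \<in> const_term 1"
proof -
  obtain x1 y1 x2 y2 x3 y3 where zw: "z = (x1, y1)" "w = (x2, y2)" "v = (x3, y3)"
    by (cases z, cases w, cases v)
  define m where "m = gd * (x1 * x2 - gc * y1 * y2) * (x1 * y2 + y1 * x2) * x3 * y3"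
  have "m \<in> const_term (pvar 1 * (0 * 0 - pvar 0 * 0 * 0) * (0 * 0 + 0 * 0) * 0 * 0)"
    unfolding m_def using assms
    by (intro const_term_mult const_term_add const_term_diff gd_in_const_term gc_in_const_term)
      (simp_all add: zw)
  then have m: "m \<in> const_term 0" by simp
  note d = delta_const_term[OF assms(1-4)]
  have comm: "gd * x1 * x2 * y1 * y2 = gd * x1 * y1 * x2 * y2"
    by (simp add: mult_ac)
  have "delta_x z w \<noteq> 0" "delta_y z w \<noteq> 0"
    using d(1,2) by (auto dest: const_term_nonzero)
  then have n: "m / (delta_x z w * delta_y z w) * (delta_x z w * delta_y z w) = m"
    by simp
  have g: "gen_add z w = ((x1 * x2 - gc * y1 * y2) / delta_x z w, (x1 * y2 + y1 * x2) / delta_y z w)"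
    by (simp add: zw comm)
  have "delta_x (gen_add z w) v = 1 - m / (delta_x z w * delta_y z w)"
    "delta_y (gen_add z w) v = 1 + m / (delta_x z w * delta_y z w)"
    "delta_x v (gen_add z w) = 1 - m / (delta_x z w * delta_y z w)"
    "delta_y v (gen_add z w) = 1 + m / (delta_x z w * delta_y z w)"
    unfolding g zw(3) by (simp_all add: m_def mult_ac)
  then have "delta_x (gen_add z w) v * delta z w = delta z w - m"
    "delta_y (gen_add z w) v * delta z w = delta z w + m"
    "delta_x v (gen_add z w) * delta z w = delta z w - m"
    "delta_y v (gen_add z w) * delta z w = delta z w + m"
    using n by (simp_all add: delta_def left_diff_distrib distrib_right)
  then show "delta_x (gen_add z w) v * delta z w \<in> const_term 1"
    "delta_y (gen_add z w) v * delta z w \<in> const_term 1"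
    "delta_x v (gen_add z w) * delta z w \<in> const_term 1"
    "delta_y v (gen_add z w) * delta z w \<in> const_term 1"
    using const_term_diff[OF d(3) m] const_term_add[OF d(3) m] by simp_all
qed

lemma Delta_x_const_term: "Delta_x \<in> const_term 1"
proof -
  have "Delta_x = (delta_x (gen_add z1 z2) z3 * delta z1 z2) *
      (delta_x z1 (gen_add z2 z3) * delta z2 z3)"
    by (simp add: Delta_x_def z3'_def z1'_def mult_ac)
  also have "\<dots> \<in> const_term (1 * 1)"
    by (intro const_term_mult delta_gen_add_const_term z_in_const_term)
  finally show ?thesis by simp
qed

lemma Delta_y_const_term: "Delta_y \<in> const_term 1"
proof -
  have "Delta_y = (delta_y (gen_add z1 z2) z3 * delta z1 z2) *
      (delta_y z1 (gen_add z2 z3) * delta z2 z3)"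
    by (simp add: Delta_y_def z3'_def z1'_def mult_ac)
  also have "\<dots> \<in> const_term (1 * 1)"
    by (intro const_term_mult delta_gen_add_const_term z_in_const_term)
  finally show ?thesis by simp
qed

lemma denom_const_term: "denom \<in> const_term 1"
proof -
  have "denom \<in> const_term (1 * 1 * 1 * 1)"
    unfolding denom_def
    by (intro const_term_mult delta_const_term z_in_const_term Delta_x_const_term Delta_y_const_term)
  then show ?thesis by simp
qed

lemma cring_localization_denom: "cring (localization denom)"
  using denom_const_term const_term_nonzero[OF denom_const_term]
  by (auto simp: const_term_def intro: cring_localization)

end

theory Submission
  imports Defs
begin

text \<open>
  Clearing denominators turns each coordinate of
  $(z_1 \oplus z_2) \oplus z_3 - z_1 \oplus (z_2 \oplus z_3)$ into a polynomial. Multivariate division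
  shows that this polynomial lies in the ideal generated by $e(z_1), e(z_2), e(z_3)$, with cofactors
  that have integer coefficients. All denominators divide \<open>denom\<close>, hence are units of the
  localization, so $\phi$ maps the difference to zero.
\<close>

section \<open>The polynomial identities\<close>

text \<open>
  The cofactors come from multivariate division by $e(z_1), e(z_2), e(z_3)$, after dividing by the
  common factor $d x_2 y_2$. The exchange of $z_1$ and $z_3$ changes the sign of the dividend, and
  accordingly the cofactor of $e(z_3)$ is, up to sign, that of $e(z_1)$ with $z_1$ and $z_3$
  exchanged.
\<close>

definition cofactor_x1 :: "'a::comm_ring_1 \<Rightarrow> 'a \<Rightarrow> 'a \<Rightarrow> 'a \<Rightarrow> 'a \<Rightarrow> 'a \<Rightarrow> 'a \<Rightarrow> 'a \<Rightarrow> 'a"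
  where "cofactor_x1 c d x1 y1 x2 y2 x3 y3 =
     c * d * x1 * x2^2 * y2^3 * x3 * y3^2 + c * y1 * x2^3 * x3 * y3^2 + x1 * x2^3 * x3^2 * y3 +
     x1 * x2^2 * y2 * x3^3 + c^2 * y1 * y2^3 * x3^2 * y3 + c * y1 * x2^2 * y2 * y3 +
     c * x1 * x2 * y2^2 * y3 + c * y1 * x2 * y2^2 * x3 - c * d * y1 * x2^3 * y2^2 * x3 * y3^2 -
     d * x1 * x2^3 * y2^2 * x3^2 * y3 - c * d * y1 * x2^2 * y2^3 * x3^2 * y3 -
     c^2 * y1 * x2^2 * y2 * y3^3 - c^2 * x1 * x2 * y2^2 * y3^3 - c^2 * x1 * y2^3 * x3 * y3^2 -
     c * y1 * x2 * y2^2 * x3^3 - x1 * x2^2 * y2 * x3"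

definition cofactor_x2 :: "'a::comm_ring_1 \<Rightarrow> 'a \<Rightarrow> 'a \<Rightarrow> 'a \<Rightarrow> 'a \<Rightarrow> 'a \<Rightarrow> 'a \<Rightarrow> 'a"
  where "cofactor_x2 c x1 y1 x2 y2 x3 y3 =
     c^2 * x1 * y1^2 * x2 * y3^3 + c^2 * x1^2 * y1 * y2 * y3^3 + c * x1^3 * y2 * x3 * y3^2 +
     x1^2 * y1 * x2 * x3^3 + c * y1 * x2 * x3 * y3^2 + c * x1 * y1^2 * y2 * x3 +
     x1 * x2 * x3^2 * y3 + c * y1 * y2 * x3^2 * y3 - x1^3 * x2 * x3^2 * y3 -
     c^2 * y1^3 * x2 * x3 * y3^2 - c^2 * y1^3 * y2 * x3^2 * y3 - c * x1 * y1^2 * y2 * x3^3 -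
     c * x1 * y1^2 * x2 * y3 - c * x1^2 * y1 * y2 * y3 - x1^2 * y1 * x2 * x3 -
     c * x1 * y2 * x3 * y3^2"

definition cofactor_y1 :: "'a::comm_ring_1 \<Rightarrow> 'a \<Rightarrow> 'a \<Rightarrow> 'a \<Rightarrow> 'a \<Rightarrow> 'a \<Rightarrow> 'a \<Rightarrow> 'a \<Rightarrow> 'a"
  where "cofactor_y1 c d x1 y1 x2 y2 x3 y3 =
     c * d * y1 * x2^2 * y2^3 * x3 * y3^2 + d * x1 * x2^2 * y2^3 * x3^2 * y3 +
     d * x1 * x2^3 * y2^2 * x3 * y3^2 + c * x1 * x2^2 * y2 * y3^3 + c * y1 * x2 * y2^2 * y3 +
     x1 * x2 * y2^2 * x3^3 + y1 * x2^2 * y2 * x3^3 + y1 * x2^3 * x3^2 * y3 -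
     c^2 * y1 * y2^3 * x3 * y3^2 - c^2 * y1 * x2 * y2^2 * y3^3 - c * x1 * y2^3 * x3^2 * y3 -
     d * y1 * x2^3 * y2^2 * x3^2 * y3 - x1 * x2^3 * x3 * y3^2 - x1 * x2 * y2^2 * x3 -
     y1 * x2^2 * y2 * x3 - x1 * x2^2 * y2 * y3"

definition cofactor_y2 :: "'a::comm_ring_1 \<Rightarrow> 'a \<Rightarrow> 'a \<Rightarrow> 'a \<Rightarrow> 'a \<Rightarrow> 'a \<Rightarrow> 'a \<Rightarrow> 'a"
  where "cofactor_y2 c x1 y1 x2 y2 x3 y3 =
     c^2 * y1^3 * y2 * x3 * y3^2 + c * x1^2 * y1 * x2 * y3^3 + c * x1 * y1^2 * y2 * y3 +
     x1^3 * y2 * x3^2 * y3 + x1^3 * x2 * x3 * y3^2 + x1^2 * y1 * y2 * x3 + x1 * y1^2 * x2 * x3 +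
     y1 * x2 * x3^2 * y3 - c^2 * x1 * y1^2 * y2 * y3^3 - c * y1^3 * x2 * x3^2 * y3 -
     x1^2 * y1 * y2 * x3^3 - x1 * y1^2 * x2 * x3^3 - x1^2 * y1 * x2 * y3 -
     c * y1 * y2 * x3 * y3^2 - x1 * y2 * x3^2 * y3 - x1 * x2 * x3 * y3^2"

text \<open>Here \<open>(a / p, b / q)\<close> is z1 \<oplus> z2 and
  \<open>(a' / p', b' / q')\<close> is z2 \<oplus> z3. Cross-multiplying the first coordinates of
  the two triple sums, after scaling by \<open>p * q\<close> and \<open>p' * q'\<close>, gives the
  left side. Both sides expand to the same integer polynomial, so any commutative ring will
  do.\<close>

lemma assoc_x_polynomial:
  fixes c d x1 y1 x2 y2 x3 y3 :: "'a::comm_ring_1"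
  defines "a \<equiv> x1 * x2 - c * y1 * y2" and "b \<equiv> x1 * y2 + y1 * x2"
    and "p \<equiv> 1 - d * x1 * x2 * y1 * y2" and "q \<equiv> 1 + d * x1 * x2 * y1 * y2"
    and "a' \<equiv> x2 * x3 - c * y2 * y3" and "b' \<equiv> x2 * y3 + y2 * x3"
    and "p' \<equiv> 1 - d * x2 * x3 * y2 * y3" and "q' \<equiv> 1 + d * x2 * x3 * y2 * y3"
  shows "(a * q * x3 - c * (b * p) * y3) * (p' * q' - d * x1 * a' * y1 * b') -
      (x1 * (a' * q') - c * y1 * (b' * p')) * (p * q - d * a * x3 * b * y3) =
    d * x2 * y2 *
      (cofactor_x1 c d x1 y1 x2 y2 x3 y3 * (x1\<^sup>2 + c * y1\<^sup>2 - 1 - d * x1\<^sup>2 * y1\<^sup>2) +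
       cofactor_x2 c x1 y1 x2 y2 x3 y3 * (x2\<^sup>2 + c * y2\<^sup>2 - 1 - d * x2\<^sup>2 * y2\<^sup>2) -
       cofactor_x1 c d x3 y3 x2 y2 x1 y1 * (x3\<^sup>2 + c * y3\<^sup>2 - 1 - d * x3\<^sup>2 * y3\<^sup>2))"
  unfolding assms cofactor_x1_def cofactor_x2_def
  by (simp add: algebra_simps power2_eq_square power3_eq_cube)

text \<open>The counterpart for the second coordinates, whose outer denominators carry a plus
  sign.\<close>

lemma assoc_y_polynomial:
  fixes c d x1 y1 x2 y2 x3 y3 :: "'a::comm_ring_1"
  defines "a \<equiv> x1 * x2 - c * y1 * y2" and "b \<equiv> x1 * y2 + y1 * x2"
    and "p \<equiv> 1 - d * x1 * x2 * y1 * y2" and "q \<equiv> 1 + d * x1 * x2 * y1 * y2"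
    and "a' \<equiv> x2 * x3 - c * y2 * y3" and "b' \<equiv> x2 * y3 + y2 * x3"
    and "p' \<equiv> 1 - d * x2 * x3 * y2 * y3" and "q' \<equiv> 1 + d * x2 * x3 * y2 * y3"
  shows "(a * q * y3 + b * p * x3) * (p' * q' + d * x1 * a' * y1 * b') -
      (x1 * (b' * p') + y1 * (a' * q')) * (p * q + d * a * x3 * b * y3) =
    d * x2 * y2 *
      (cofactor_y1 c d x1 y1 x2 y2 x3 y3 * (x1\<^sup>2 + c * y1\<^sup>2 - 1 - d * x1\<^sup>2 * y1\<^sup>2) +
       cofactor_y2 c x1 y1 x2 y2 x3 y3 * (x2\<^sup>2 + c * y2\<^sup>2 - 1 - d * x2\<^sup>2 * y2\<^sup>2) -
       cofactor_y1 c d x3 y3 x2 y2 x1 y1 * (x3\<^sup>2 + c * y3\<^sup>2 - 1 - d * x3\<^sup>2 * y3\<^sup>2))"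
  unfolding assms cofactor_y1_def cofactor_y2_def
  by (simp add: algebra_simps power2_eq_square power3_eq_cube power4_eq_xxxx)

section \<open>Clearing nested denominators in a field\<close>

lemma divide_minus_divide_clear:
  fixes u v u' v' k k' :: "'a::field"
  assumes "k \<noteq> 0" "k' \<noteq> 0" "v \<noteq> 0" "v' \<noteq> 0"
  shows "u / v - u' / v' = ((u * k) * (v' * k') - (u' * k') * (v * k)) / ((v * k) * (v' * k'))"
  using assms by (simp add: field_simps)

text \<open>The right sides stay quotients on purpose: the numerator is a combination of the three
  curve equations, and the denominator is a product of factors that will be units in the
  localization.\<close>

lemma assoc_field:
  fixes c d x1 y1 x2 y2 x3 y3 :: "'a::field"
  defines "e \<equiv> \<lambda>x y. x\<^sup>2 + c * y\<^sup>2 - 1 - d * x\<^sup>2 * y\<^sup>2"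
  defines "p \<equiv> 1 - d * x1 * x2 * y1 * y2" and "q \<equiv> 1 + d * x1 * x2 * y1 * y2"
    and "p' \<equiv> 1 - d * x2 * x3 * y2 * y3" and "q' \<equiv> 1 + d * x2 * x3 * y2 * y3"
  defines "X \<equiv> (x1 * x2 - c * y1 * y2) / p" and "Y \<equiv> (x1 * y2 + y1 * x2) / q"
    and "X' \<equiv> (x2 * x3 - c * y2 * y3) / p'" and "Y' \<equiv> (x2 * y3 + y2 * x3) / q'"
  defines "r \<equiv> 1 - d * X * x3 * Y * y3" and "s \<equiv> 1 + d * X * x3 * Y * y3"
    and "r' \<equiv> 1 - d * x1 * X' * y1 * Y'" and "s' \<equiv> 1 + d * x1 * X' * y1 * Y'"
  assumes nz: "p \<noteq> 0" "q \<noteq> 0" "p' \<noteq> 0" "q' \<noteq> 0" and nz': "r \<noteq> 0" "s \<noteq> 0" "r' \<noteq> 0" "s' \<noteq> 0"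
  shows "(X * x3 - c * Y * y3) / r - (x1 * X' - c * y1 * Y') / r' =
      d * x2 * y2 * (cofactor_x1 c d x1 y1 x2 y2 x3 y3 * e x1 y1 +
        cofactor_x2 c x1 y1 x2 y2 x3 y3 * e x2 y2 - cofactor_x1 c d x3 y3 x2 y2 x1 y1 * e x3 y3) /
      (r * (p * q) * (r' * (p' * q')))" (is ?x)
    and "(X * y3 + Y * x3) / s - (x1 * Y' + y1 * X') / s' =
      d * x2 * y2 * (cofactor_y1 c d x1 y1 x2 y2 x3 y3 * e x1 y1 +
        cofactor_y2 c x1 y1 x2 y2 x3 y3 * e x2 y2 - cofactor_y1 c d x3 y3 x2 y2 x1 y1 * e x3 y3) /
      (s * (p * q) * (s' * (p' * q')))" (is ?y)
proof -
  define a b where "a = x1 * x2 - c * y1 * y2" and "b = x1 * y2 + y1 * x2"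
  define a' b' where "a' = x2 * x3 - c * y2 * y3" and "b' = x2 * y3 + y2 * x3"
  have XY: "X = a / p" "Y = b / q" "X' = a' / p'" "Y' = b' / q'"
    unfolding X_def Y_def X'_def Y'_def a_def b_def a'_def b'_def by simp_all
  have k: "p * q \<noteq> 0" "p' * q' \<noteq> 0"
    using nz by simp_all
  \<comment> \<open>One factor \<open>p * q\<close> clears everything built from \<open>X\<close>
    and \<open>Y\<close>: their denominators are \<open>p\<close> and \<open>q\<close>, and that of
    \<open>X * Y\<close> is \<open>p * q\<close>. The same holds for the primed quantities.\<close>
  have clear:
    "(X * x3 - c * Y * y3) * (p * q) = a * q * x3 - c * (b * p) * y3"
    "(x1 * X' - c * y1 * Y') * (p' * q') = x1 * (a' * q') - c * y1 * (b' * p')"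
    "(X * y3 + Y * x3) * (p * q) = a * q * y3 + b * p * x3"
    "(x1 * Y' + y1 * X') * (p' * q') = x1 * (b' * p') + y1 * (a' * q')"
    "r * (p * q) = p * q - d * a * x3 * b * y3"
    "s * (p * q) = p * q + d * a * x3 * b * y3"
    "r' * (p' * q') = p' * q' - d * x1 * a' * y1 * b'"
    "s' * (p' * q') = p' * q' + d * x1 * a' * y1 * b'"
    using nz by (simp_all add: r_def s_def r'_def s'_def XY field_simps)
  show ?x
    \<comment> \<open>Used with \<open>k = p * q\<close> and \<open>k' = p' * q'\<close>. The rules
      \<open>clear\<close> also rewrite the denominator on the right, so the two denominators agree
      and only the polynomial identity for the numerators remains.\<close>
    unfolding divide_minus_divide_clear[OF k nz'(1,3)] clear
    unfolding a_def b_def a'_def b'_def p_def q_def p'_def q'_def e_def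
    by (simp only: assoc_x_polynomial)
  show ?y
    unfolding divide_minus_divide_clear[OF k nz'(2,4)] clear
    unfolding a_def b_def a'_def b'_def p_def q_def p'_def q'_def e_def
    by (simp only: assoc_y_polynomial)
qed

section \<open>Homomorphisms from a localization\<close>

lemma localization_simps [simp]:
  "a \<otimes>\<^bsub>localization f\<^esub> b = a * b" "\<one>\<^bsub>localization f\<^esub> = 1"
  "a \<oplus>\<^bsub>localization f\<^esub> b = a + b" "\<zero>\<^bsub>localization f\<^esub> = 0"
  by (simp_all add: localization_def)

lemma Fract_in_localization: "Fract p 1 \<in> carrier (localization f)"
proof -
  have "Fract p 1 = Fract p 1 / f ^ 0"
    by simp
  then show ?thesis
    unfolding localization_def by (simp only: partial_object.simps mem_Collect_eq) blast
qed

lemma const_term_subset_localization: "const_term k \<subseteq> carrier (localization f)"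
  by (auto simp: const_term_def Fract_in_localization)

lemma denom_in_Units: "denom \<in> Units (localization denom)"
proof -
  have "Fract 1 1 / denom ^ 1 \<in> carrier (localization denom)"
    unfolding localization_def by (simp only: partial_object.simps mem_Collect_eq) blast
  then have "inverse denom \<in> carrier (localization denom)"
    by (simp add: divide_inverse flip: One_fract_def)
  moreover have "denom \<in> carrier (localization denom)" "denom \<noteq> 0"
    using denom_const_term const_term_subset_localization const_term_nonzero by blast+
  ultimately show ?thesis
    by (auto simp: Units_def intro!: bexI[of _ "inverse denom"])
qed

text \<open>The localization lies inside a field, so its elements are handled by field arithmetic;
  only membership in \<open>L\<close> or \<open>U\<close> has to be tracked before \<phi> is
  applied.\<close>

locale localization_hom = ring_hom_cring "localization f" A \<phi>
  for f :: "'b::idom fract" and A :: "('a, 'm) ring_scheme" (structure) and \<phi>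
begin

abbreviation "L \<equiv> carrier (localization f)"
abbreviation "U \<equiv> Units (localization f)"

text \<open>The additive inverse of a ring record is a definite description, so it is identified
  with field negation through its defining equation.\<close>

lemma a_inv_eq: "a \<in> L \<Longrightarrow> \<ominus>\<^bsub>localization f\<^esub> a = - a"
  using R.l_neg[of a] by (simp add: eq_neg_iff_add_eq_0)

lemma localization_closed [simp]:
  "0 \<in> L" "1 \<in> L"
  "a \<in> L \<Longrightarrow> b \<in> L \<Longrightarrow> a + b \<in> L"
  "a \<in> L \<Longrightarrow> b \<in> L \<Longrightarrow> a * b \<in> L"
  "a \<in> L \<Longrightarrow> - a \<in> L"
  using R.zero_closed R.one_closed R.a_closed[of a b] R.m_closed[of a b] R.a_inv_closed[of a]
  by (simp_all add: a_inv_eq)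

lemma diff_closed [simp]: "a \<in> L \<Longrightarrow> b \<in> L \<Longrightarrow> a - b \<in> L"
  using localization_closed(3)[of a "- b"] by simp

lemma power_closed [simp]: "a \<in> L \<Longrightarrow> a ^ n \<in> L"
  by (induction n) simp_all

lemma hom_localization [simp]:
  "\<phi> 0 = \<zero>" "\<phi> 1 = \<one>"
  "a \<in> L \<Longrightarrow> b \<in> L \<Longrightarrow> \<phi> (a + b) = \<phi> a \<oplus> \<phi> b"
  "a \<in> L \<Longrightarrow> b \<in> L \<Longrightarrow> \<phi> (a * b) = \<phi> a \<otimes> \<phi> b"
  using hom_zero hom_one hom_add[of a b] hom_mult[of a b] by simp_all

lemma hom_diff [simp]:
  assumes "a \<in> L" "b \<in> L"
  shows "\<phi> (a - b) = \<phi> a \<ominus> \<phi> b"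
proof -
  have "\<phi> (a - b) = \<phi> (a + - b)"
    by simp
  also have "\<dots> = \<phi> a \<oplus> \<phi> (- b)"
    using assms by (intro hom_localization) simp_all
  also have "\<phi> (- b) = \<ominus> \<phi> b"
    using hom_a_inv[of b] assms by (simp add: a_inv_eq)
  finally show ?thesis
    by (simp add: a_minus_def)
qed

lemma Units_inverse:
  assumes "a \<in> U"
  shows "a \<noteq> 0" "a \<in> L" "inverse a \<in> L" "\<phi> a \<in> Units A" "\<phi> (inverse a) = inv \<phi> a"
proof -
  obtain b where b: "a \<in> L" "b \<in> L" "a * b = 1"
    using assms by (auto simp: Units_def)
  then have "b = inverse a"
    by (metis inverse_unique)
  with b show inv: "a \<noteq> 0" "a \<in> L" "inverse a \<in> L"
    by auto
  then have *: "\<phi> a \<otimes> \<phi> (inverse a) = \<one>"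
    by (simp flip: hom_localization(4))
  then show "\<phi> a \<in> Units A"
    using inv S.m_comm[of "\<phi> a" "\<phi> (inverse a)"]
    by (auto simp: Units_def intro!: bexI[of _ "\<phi> (inverse a)"])
  show "\<phi> (inverse a) = inv \<phi> a"
    using * inv by (intro S.comm_inv_char[symmetric]) simp_all
qed

text \<open>A divisor of a unit is a unit: if \<open>a * b * x = 1\<close>, then
  \<open>b * x\<close> inverts \<open>a\<close>. This is how invertibility passes from
  \<open>denom\<close> to its factors.\<close>

lemma Units_mult_iff:
  assumes "a \<in> L" "b \<in> L"
  shows "a * b \<in> U \<longleftrightarrow> a \<in> U \<and> b \<in> U"
proof
  assume "a * b \<in> U"
  then obtain x where x: "x \<in> L" "a * b * x = 1"
    by (auto simp: Units_def)
  have "a * (b * x) = 1" "b * (a * x) = 1"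
    using x by (simp_all add: mult_ac)
  then show "a \<in> U \<and> b \<in> U"
    using x(1) assms
    by (auto simp: Units_def mult.commute intro: bexI[of _ "b * x"] bexI[of _ "a * x"])
next
  assume "a \<in> U \<and> b \<in> U"
  then show "a * b \<in> U"
    using R.Units_m_closed[of a b] by simp
qed

text \<open>The difference is \<open>n * inverse u\<close> with both factors in the localization, so
  it lies in the kernel together with \<open>n\<close>.\<close>

lemma hom_eqI:
  assumes "a \<in> L" "b \<in> L" "a - b = n / u" "n \<in> L" "\<phi> n = \<zero>" "u \<in> U"
  shows "\<phi> a = \<phi> b"
proof -
  have "a = b + n * inverse u"
    using assms(3) by (simp add: divide_inverse diff_eq_eq add.commute)
  also have "\<phi> \<dots> = \<phi> b"
    using assms(2,4,5) Units_inverse(3)[OF assms(6)] by simp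
  finally show ?thesis .
qed

lemma cofactor_closed:
  assumes "c \<in> L" "d \<in> L" "x1 \<in> L" "y1 \<in> L" "x2 \<in> L" "y2 \<in> L" "x3 \<in> L" "y3 \<in> L"
  shows "cofactor_x1 c d x1 y1 x2 y2 x3 y3 \<in> L" "cofactor_x2 c x1 y1 x2 y2 x3 y3 \<in> L"
    "cofactor_y1 c d x1 y1 x2 y2 x3 y3 \<in> L" "cofactor_y2 c x1 y1 x2 y2 x3 y3 \<in> L"
  unfolding cofactor_x1_def cofactor_x2_def cofactor_y1_def cofactor_y2_def
  by (intro diff_closed localization_closed power_closed assms)+

end


section \<open>Associativity\<close>

text \<open>The addition formula and \<open>delta_x\<close>, \<open>delta_y\<close> order the
  factors differently; this reconciles the two forms.\<close>

lemma Edwards_denominators: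
  "1 - gd * x1 * x2 * y1 * y2 = delta_x (x1, y1) (x2, y2)"
  "1 + gd * x1 * x2 * y1 * y2 = delta_y (x1, y1) (x2, y2)"
  by (simp_all add: mult_ac)

locale generic_hom = localization_hom denom A \<phi> for A :: "('a, 'm) ring_scheme" (structure) and \<phi>
begin

section \<open>The generic addition and its image under \<phi>\<close>

lemma gc_closed [simp]: "gc \<in> L" and gd_closed [simp]: "gd \<in> L"
  by (simp_all add: gc_def gd_def Fract_in_localization)

lemma delta_closed:
  assumes "z \<in> L \<times> L" "w \<in> L \<times> L"
  shows "delta_x z w \<in> L" "delta_y z w \<in> L" "delta z w \<in> L"
  using assms by (cases z, cases w; simp add: delta_def)+

text \<open>Numerators and denominators are polynomial in the coordinates, and \<phi> preserves
  inverses of units; hence \<phi> commutes with the addition wherever both denominators are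
  units.\<close>

lemma edwards_hom:
  assumes "z \<in> L \<times> L" "w \<in> L \<times> L"
    and "delta_x z w \<in> U" "delta_y z w \<in> U"
  shows "gen_add z w \<in> L \<times> L"
    and "edwards_defined A (\<phi> gd) (map_prod \<phi> \<phi> z) (map_prod \<phi> \<phi> w)"
    and "edwards_add A (\<phi> gc) (\<phi> gd) (map_prod \<phi> \<phi> z) (map_prod \<phi> \<phi> w) =
      map_prod \<phi> \<phi> (gen_add z w)"
proof -
  obtain x1 y1 x2 y2 where zw: "z = (x1, y1)" "w = (x2, y2)"
    by (cases z, cases w)
  have L: "x1 \<in> L" "y1 \<in> L" "x2 \<in> L" "y2 \<in> L"
    using assms(1,2) by (simp_all add: zw)
  note ux = Units_inverse[OF assms(3)] and uy = Units_inverse[OF assms(4)]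
  have num: "x1 * x2 - gc * y1 * y2 \<in> L" "x1 * y2 + y1 * x2 \<in> L"
    using L by simp_all
  have gen_add: "gen_add z w =
      ((x1 * x2 - gc * y1 * y2) * inverse (delta_x z w), (x1 * y2 + y1 * x2) * inverse (delta_y z w))"
    unfolding zw gen_add.simps Edwards_denominators divide_inverse ..
  show "gen_add z w \<in> L \<times> L"
    unfolding gen_add using num ux(3) uy(3) by simp
  have den: "\<one> \<ominus> \<phi> gd \<otimes> \<phi> x1 \<otimes> \<phi> x2 \<otimes> \<phi> y1 \<otimes> \<phi> y2 = \<phi> (delta_x z w)"
    "\<one> \<oplus> \<phi> gd \<otimes> \<phi> x1 \<otimes> \<phi> x2 \<otimes> \<phi> y1 \<otimes> \<phi> y2 = \<phi> (delta_y z w)"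
    unfolding zw Edwards_denominators[symmetric] using L by simp_all
  show "edwards_defined A (\<phi> gd) (map_prod \<phi> \<phi> z) (map_prod \<phi> \<phi> w)"
    using den ux(4) uy(4) by (simp add: zw)
  have "map_prod \<phi> \<phi> (gen_add z w) =
      (\<phi> (x1 * x2 - gc * y1 * y2) \<otimes> inv \<phi> (delta_x z w), \<phi> (x1 * y2 + y1 * x2) \<otimes> inv \<phi> (delta_y z w))"
    unfolding gen_add using num ux(3,5) uy(3,5) by simp
  also have "\<dots> = edwards_add A (\<phi> gc) (\<phi> gd) (map_prod \<phi> \<phi> z) (map_prod \<phi> \<phi> w)"
    unfolding den[symmetric] using L by (simp add: zw)
  finally show "edwards_add A (\<phi> gc) (\<phi> gd) (map_prod \<phi> \<phi> z) (map_prod \<phi> \<phi> w) =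
      map_prod \<phi> \<phi> (gen_add z w)" ..
qed

section \<open>Invertibility of all denominators\<close>

lemma points_closed: "z1 \<in> L \<times> L" "z2 \<in> L \<times> L" "z3 \<in> L \<times> L"
  by (simp_all add: z1_def z2_def z3_def Fract_in_localization)

lemma denom_factors: "delta z1 z2 * delta z2 z3 * Delta_x * Delta_y \<in> U"
  by (fold denom_def) (rule denom_in_Units)

lemma Delta_closed: "Delta_x \<in> L" "Delta_y \<in> L"
  using Delta_x_const_term Delta_y_const_term const_term_subset_localization by blast+

lemma delta_Units:
  "delta_x z1 z2 \<in> U" "delta_y z1 z2 \<in> U" "delta_x z2 z3 \<in> U" "delta_y z2 z3 \<in> U"
proof -
  have "delta z1 z2 \<in> U" "delta z2 z3 \<in> U"
    using denom_factors by (simp_all add: Units_mult_iff delta_closed points_closed Delta_closed)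
  then show "delta_x z1 z2 \<in> U" "delta_y z1 z2 \<in> U" "delta_x z2 z3 \<in> U" "delta_y z2 z3 \<in> U"
    unfolding delta_def by (simp_all add: Units_mult_iff delta_closed points_closed)
qed

lemmas edwards_hom_12 = edwards_hom[OF points_closed(1,2) delta_Units(1,2), folded z3'_def]
  and edwards_hom_23 = edwards_hom[OF points_closed(2,3) delta_Units(3,4), folded z1'_def]

text \<open>Splitting \<open>Delta_x\<close> and \<open>Delta_y\<close> requires each factor to lie
  in \<open>L\<close>, hence also the coordinates of \<open>z3'\<close> and \<open>z1'\<close>. That
  is known only once the inner denominators are units, so the outer ones come second.\<close>

lemma delta_Units':
  "delta_x z3' z3 \<in> U" "delta_y z3' z3 \<in> U" "delta_x z1 z1' \<in> U" "delta_y z1 z1' \<in> U"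
proof -
  have "Delta_x \<in> U" "Delta_y \<in> U"
    using denom_factors by (simp_all add: Units_mult_iff delta_closed points_closed Delta_closed)
  then show "delta_x z3' z3 \<in> U" "delta_y z3' z3 \<in> U" "delta_x z1 z1' \<in> U" "delta_y z1 z1' \<in> U"
    unfolding Delta_x_def Delta_y_def
    by (simp_all add: Units_mult_iff delta_closed points_closed edwards_hom_12(1) edwards_hom_23(1))
qed

lemmas edwards_hom_12_3 = edwards_hom[OF edwards_hom_12(1) points_closed(3) delta_Units'(1,2)]
  and edwards_hom_1_23 = edwards_hom[OF points_closed(1) edwards_hom_23(1) delta_Units'(3,4)]

lemma hom_gen_add_assoc:
  assumes "\<phi> (curve z1) = \<zero>" "\<phi> (curve z2) = \<zero>" "\<phi> (curve z3) = \<zero>"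
  shows "map_prod \<phi> \<phi> (gen_add z3' z3) = map_prod \<phi> \<phi> (gen_add z1 z1')"
proof -
  obtain x1 y1 x2 y2 x3 y3 where z: "z1 = (x1, y1)" "z2 = (x2, y2)" "z3 = (x3, y3)"
    by (cases z1, cases z2, cases z3)
  obtain X Y X' Y' where z': "z3' = (X, Y)" "z1' = (X', Y')"
    by (cases z3', cases z1')
  have XY: "X = (x1 * x2 - gc * y1 * y2) / (1 - gd * x1 * x2 * y1 * y2)"
    "Y = (x1 * y2 + y1 * x2) / (1 + gd * x1 * x2 * y1 * y2)"
    "X' = (x2 * x3 - gc * y2 * y3) / (1 - gd * x2 * x3 * y2 * y3)"
    "Y' = (x2 * y3 + y2 * x3) / (1 + gd * x2 * x3 * y2 * y3)"
    using z'(1)[unfolded z3'_def] z'(2)[unfolded z1'_def] by (simp_all add: z)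
  have L: "x1 \<in> L" "y1 \<in> L" "x2 \<in> L" "y2 \<in> L" "x3 \<in> L" "y3 \<in> L"
    using points_closed by (simp_all add: z)
  have curve_L: "curve z1 \<in> L" "curve z2 \<in> L" "curve z3 \<in> L"
    using L by (simp_all add: z)
  have curve: "curve z1 = x1\<^sup>2 + gc * y1\<^sup>2 - 1 - gd * x1\<^sup>2 * y1\<^sup>2"
    "curve z2 = x2\<^sup>2 + gc * y2\<^sup>2 - 1 - gd * x2\<^sup>2 * y2\<^sup>2"
    "curve z3 = x3\<^sup>2 + gc * y3\<^sup>2 - 1 - gd * x3\<^sup>2 * y3\<^sup>2"
    by (simp_all add: z)
  \<comment> \<open>This is the shape of both numerators in \<open>assoc_field\<close>; each summand
    contains a curve equation that \<phi> kills.\<close>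
  have comb: "gd * x2 * y2 * (g1 * curve z1 + g2 * curve z2 - g3 * curve z3) \<in> L"
    "\<phi> (gd * x2 * y2 * (g1 * curve z1 + g2 * curve z2 - g3 * curve z3)) = \<zero>"
    if "g1 \<in> L" "g2 \<in> L" "g3 \<in> L" for g1 g2 g3
    using that L curve_L assms by (simp_all add: S.minus_eq)
  note units = delta_Units[unfolded z, folded Edwards_denominators]
    delta_Units'[unfolded z z', folded Edwards_denominators]
  \<comment> \<open>The arguments follow the first occurrences of the variables in the premises, so
    \<open>gc\<close> comes last. The eight facts \<open>units\<close> are listed in the order of
    the nonvanishing premises.\<close>
  note assoc = assoc_field[of gd x1 x2 y1 y2 x3 y3 gc, folded XY curve,
      OF units[THEN Units_inverse(1)]]
  have "gen_add z3' z3 \<in> L \<times> L" "gen_add z1 z1' \<in> L \<times> L"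
    by (rule edwards_hom_12_3(1) edwards_hom_1_23(1))+
  then have add_L:
    "(X * x3 - gc * Y * y3) / (1 - gd * X * x3 * Y * y3) \<in> L"
    "(X * y3 + Y * x3) / (1 + gd * X * x3 * Y * y3) \<in> L"
    "(x1 * X' - gc * y1 * Y') / (1 - gd * x1 * X' * y1 * Y') \<in> L"
    "(x1 * Y' + y1 * X') / (1 + gd * x1 * X' * y1 * Y') \<in> L"
    by (simp_all add: z z')
  have mult_U: "a * b \<in> U" if "a \<in> U" "b \<in> U" for a b
    using R.Units_m_closed[of a b] that by simp
  show ?thesis
    unfolding z z' gen_add.simps map_prod_simp prod.inject
    \<comment> \<open>\<open>d\<close> is instantiated by hand because unification with the
      conclusions for \<open>cofactor_x2\<close> and \<open>cofactor_y2\<close> leaves it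
      undetermined.\<close>
    by (intro conjI hom_eqI[OF add_L(1,3) assoc(1)] hom_eqI[OF add_L(2,4) assoc(2)] comb mult_U units
        cofactor_closed[where d = gd] L gc_closed gd_closed)
qed

end

theorem lemma3p3p1:
  fixes A :: "('a, 'm) ring_scheme"
    and \<phi> :: "R3 fract \<Rightarrow> 'a"
    and P1 P2 P3 :: "'a \<times> 'a"
  assumes "cring A"
    and "\<phi> \<in> ring_hom (localization denom) A"
    and "P1 = map_prod \<phi> \<phi> z1" and "P2 = map_prod \<phi> \<phi> z2" and "P3 = map_prod \<phi> \<phi> z3"
    and "\<phi> (curve z1) = \<zero>\<^bsub>A\<^esub>" and "\<phi> (curve z2) = \<zero>\<^bsub>A\<^esub>" and "\<phi> (curve z3) = \<zero>\<^bsub>A\<^esub>"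
  shows "let dfd = edwards_defined A (\<phi> gd); plus = edwards_add A (\<phi> gc) (\<phi> gd) in
    dfd P1 P2 \<and> dfd (plus P1 P2) P3 \<and> dfd P2 P3 \<and> dfd P1 (plus P2 P3) \<and>
    plus (plus P1 P2) P3 = plus P1 (plus P2 P3)"
proof -
  interpret A: cring A by fact
  interpret localization: cring "localization denom"
    by (rule cring_localization_denom)
  interpret generic_hom A \<phi>
    by unfold_locales fact
  show ?thesis
    \<comment> \<open>Every sum in \<open>A\<close> becomes the image of a generic sum, the inner
      ones first, which reduces associativity to \<open>hom_gen_add_assoc\<close>.\<close>
    unfolding Let_def assms(3-5) edwards_hom_12(3) edwards_hom_23(3) edwards_hom_12_3(3)
      edwards_hom_1_23(3)
    by (intro conjI edwards_hom_12(2) edwards_hom_23(2) edwards_hom_12_3(2) edwards_hom_1_23(2)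
        hom_gen_add_assoc assms(6-8))
qed

end
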